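(* Let $n\geqslant1$ and let $X=(X_1,X_2;\Sigma;\varphi)\in\mathfrak{X}_n$; if $n=1$, suppose $|\varphi'(0)|\neq 1$. Then there is a compact set $K\subset\mathbb{R}^2$ such that for every $q\in\mathbb{R}^2\setminus K$ the following statements hold. (a) If $n\geqslant2$, then $|\Gamma_i(q,j,t)|\to\infty$ as $j\to\infty$, for $i\in\{1,2\}$. (b) If $n=1$ and $|\varphi'(0)|>1$, then $|\Gamma_i(q,j,t)|\to\infty$ as $j\to\infty$, for $i\in\{1,2\}$. (c) If $n=1$ and $|\varphi'(0)|<1$, then $\Gamma_i(q,j,t)\to K$ as $j\to\infty$, for $i\in\{1,2\}$.
   Context: Let $\Sigma=\{(x,y)\in\mathbb{R}^2: x=0\}$, $A_1=\{x<0\}$, $A_2=\{x>0\}$. Points $(0,y)\in\Sigma$ are identified with $y\in\mathbb{R}$, and maps $\Sigma\to\Sigma$ with maps $\mathbb{R}\to\mathbb{R}$. For $n\geqslant 1$, $\mathfrak{X}_n$ is the class of hybrid systems $X=(X_1,X_2;\Sigma;\varphi)$ where, for $i\in\{1,2\}$, $X_i$ is a (possibly non-homogeneous, i.e. affine) linear vector field on $\mathbb{R}^2$, considered on $\overline{A_i}$, having a center singularity somewhere in $\mathbb{R}^2$ (so its non-constant orbits are ellipses around the center), and $\varphi:\Sigma\to\Sigma$ (the reset map) is a real polynomial of degree exactly $n$. Orbits. For $i\in\{1,2\}$ write $X_i$ enters $A_i$ at $p\in\Sigma$ if the solution of $X_i$ starting at $p$ lies in $A_i$ for all sufficiently small positive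 times. The global orbit of $X$ through $q$ is an ordered sequence of pieces $\Gamma(q,k,\cdot):[0,t_k]\to\mathbb{R}^2$, $k=1,2,\dots$, $t_k\geqslant 0$, defined as follows. - If $q\in A_i$: $\Gamma(q,1,t)$ is the solution of $X_i$ with initial condition $q$, followed until the first time $t_1>0$ at which it meets $\Sigma$. If it never meets $\Sigma$, it is followed for all $t\geqslant0$ and it is the whole orbit. - Whenever a piece governed by $X_i$ ends at a point $p\in\Sigma$, the orbit jumps to $p'=\varphi(p)$, which is the starting point of the next piece, governed by the other field $X_{i'}$, $i'\neq i$. If $X_{i'}$ enters $A_{i'}$ at $p'$, the next piece is the solution of $X_{i'}$ from $p'$ until it first returns to $\Sigma$ at a positive time; otherwise the next piece is the single point $p'$ (duration $0$), and it ends at $p'$. - If $q\in\Sigma$ there are two orbits $\Gamma_1(q,\cdot,\cdot)$ and $\Gamma_2(q,\cdot,\cdot)$: for $\Gamma_i$ the first piece starts at $q$ and is governed by $X_i$ (it is the solution of $X_i$ from $q$ until its first return to $\Sigma$ if $X_i$ enters $A_i$ at $q$, and the single point $q$ otherwise), and then one continues by the rule above. - If $q\notin\Sigma$ the orbit is unique and $\Gamma_1=\Gamma_2=\Gamma$. Here $|\Gamma_i(q,j,t)|\to\infty$ as $j\to\infty$ means that $\inf_t|\Gamma_i(q,j,t)|\to\infty$ as $j\to\infty$, and $\Gamma_i(q,j,t)\to K$ as $j\to\infty$ means that $\sup_t \operatorname{dist}(\Gamma_i(q,j,t),K)\to0$ as $j\to\infty$, where $t$ ranges over the domain $[0,t_j]$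 of the $j$-th piece. *)

theory Defs
  imports "HOL-Analysis.Analysis" "HOL-Computational_Algebra.Polynomial"
begin

type_synonym plane = "real \<times> real"

datatype zone = Z1 | Z2

fun other :: "zone \<Rightarrow> zone" where
  "other Z1 = Z2"
| "other Z2 = Z1"

fun half_plane :: "zone \<Rightarrow> plane set" where
  "half_plane Z1 = {p. fst p < 0}"
| "half_plane Z2 = {p. fst p > 0}"

definition Sigma_line :: "plane set" where
  "Sigma_line = {p. fst p = 0}"

definition solution :: "(plane \<Rightarrow> plane) \<Rightarrow> plane \<Rightarrow> (real \<Rightarrow> plane) \<Rightarrow> bool" where
  "solution F q \<gamma> \<longleftrightarrow> \<gamma> 0 = q \<and> (\<forall>t. (\<gamma> has_vector_derivative F (\<gamma> t)) (at t))"

text \<open>Only affine fields are considered below; their solutions exist for all times and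
  are unique, so the description is well defined.\<close>

definition flow :: "(plane \<Rightarrow> plane) \<Rightarrow> plane \<Rightarrow> real \<Rightarrow> plane" where
  "flow F q = (THE \<gamma>. solution F q \<gamma>)"

definition affine_field :: "(plane \<Rightarrow> plane) \<Rightarrow> bool" where
  "affine_field F \<longleftrightarrow> (\<exists>L b. linear L \<and> F = (\<lambda>z. L z + b))"

text \<open>A center is a singularity with a neighbourhood that, apart from the singularity itself,
  is filled with non-constant periodic orbits.\<close>

definition is_center :: "(plane \<Rightarrow> plane) \<Rightarrow> plane \<Rightarrow> bool" where
  "is_center F c \<longleftrightarrow> F c = 0 \<and>
     (\<exists>U. open U \<and> c \<in> U \<and>
        (\<forall>q\<in>U - {c}. \<exists>\<gamma> T. solution F q \<gamma> \<and> T > 0 \<and> (\<forall>t. \<gamma> (t + T) = \<gamma> t)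
            \<and> (\<exists>t. \<gamma> t \<noteq> q)))"

text \<open>The reset map is given on \<open>\<real>\<close>, the point \<open>(0, y)\<close> of the line being identified
  with \<open>y\<close>.\<close>

record hybrid_system =
  field_of :: "zone \<Rightarrow> plane \<Rightarrow> plane"
  reset :: "real \<Rightarrow> real"

definition hybrid_class :: "nat \<Rightarrow> hybrid_system set" where
  "hybrid_class n = {X. (\<forall>i. affine_field (field_of X i) \<and> (\<exists>c. is_center (field_of X i) c)) \<and>
     (\<exists>p :: real poly. degree p = n \<and> reset X = poly p)}"

definition jump :: "hybrid_system \<Rightarrow> plane \<Rightarrow> plane" where
  "jump X p = (0, reset X (snd p))"

definition enters :: "hybrid_system \<Rightarrow> zone \<Rightarrow> plane \<Rightarrow> bool" where
  "enters X i p \<longleftrightarrow> (\<exists>\<epsilon>>0. \<forall>t. 0 < t \<and> t < \<epsilon> \<longrightarrow> flow (field_of X i) p t \<in> half_plane i)"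

text \<open>A piece is determined by its governing zone and its starting point. It follows the
  flow when it starts inside the zone or enters it; otherwise it is a single point.\<close>

definition moving :: "hybrid_system \<Rightarrow> zone \<Rightarrow> plane \<Rightarrow> bool" where
  "moving X i p \<longleftrightarrow> p \<in> half_plane i \<or> (p \<in> Sigma_line \<and> enters X i p)"

definition meets_line :: "hybrid_system \<Rightarrow> zone \<Rightarrow> plane \<Rightarrow> bool" where
  "meets_line X i p \<longleftrightarrow> (\<exists>t>0. flow (field_of X i) p t \<in> Sigma_line)"

definition hit_time :: "hybrid_system \<Rightarrow> zone \<Rightarrow> plane \<Rightarrow> real" where
  "hit_time X i p = (LEAST t. t > 0 \<and> flow (field_of X i) p t \<in> Sigma_line)"

definition piece_times :: "hybrid_system \<Rightarrow> zone \<Rightarrow> plane \<Rightarrow> real set" where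
  "piece_times X i p =
     (if moving X i p then (if meets_line X i p then {0..hit_time X i p} else {0..}) else {0})"

text \<open>\<open>None\<close> means that the piece never meets the line, so that it is the last one.\<close>

definition piece_end :: "hybrid_system \<Rightarrow> zone \<Rightarrow> plane \<Rightarrow> plane option" where
  "piece_end X i p =
     (if moving X i p
      then (if meets_line X i p then Some (flow (field_of X i) p (hit_time X i p)) else None)
      else Some p)"

text \<open>The index \<open>i\<close> matters only for \<open>q\<close> on the line; off the line both orbits coincide.\<close>

definition first_zone :: "zone \<Rightarrow> plane \<Rightarrow> zone" where
  "first_zone i q =
     (if q \<in> half_plane Z1 then Z1 else if q \<in> half_plane Z2 then Z2 else i)"

text \<open>The pieces are numbered from \<open>0\<close>: number \<open>j\<close> is the \<open>(j + 1)\<close>-st piece of the orbit,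
  given by its governing zone and starting point, or \<open>None\<close> if the orbit has ended before.\<close>

primrec orbit_piece :: "hybrid_system \<Rightarrow> zone \<Rightarrow> plane \<Rightarrow> nat \<Rightarrow> (zone \<times> plane) option" where
  "orbit_piece X i q 0 = Some (first_zone i q, q)"
| "orbit_piece X i q (Suc j) =
     (case orbit_piece X i q j of
        None \<Rightarrow> None
      | Some (m, p) \<Rightarrow> map_option (\<lambda>e. (other m, jump X e)) (piece_end X m p))"

definition infinite_orbit :: "hybrid_system \<Rightarrow> zone \<Rightarrow> plane \<Rightarrow> bool" where
  "infinite_orbit X i q \<longleftrightarrow> (\<forall>j. orbit_piece X i q j \<noteq> None)"

definition Gamma_dom :: "hybrid_system \<Rightarrow> zone \<Rightarrow> plane \<Rightarrow> nat \<Rightarrow> real set" where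
  "Gamma_dom X i q j = (case the (orbit_piece X i q j) of (m, p) \<Rightarrow> piece_times X m p)"

definition Gamma_orbit :: "hybrid_system \<Rightarrow> zone \<Rightarrow> plane \<Rightarrow> nat \<Rightarrow> real \<Rightarrow> plane" where
  "Gamma_orbit X i q j t = (case the (orbit_piece X i q j) of (m, p) \<Rightarrow> flow (field_of X m) p t)"

definition escapes_to_infinity :: "hybrid_system \<Rightarrow> zone \<Rightarrow> plane \<Rightarrow> bool" where
  "escapes_to_infinity X i q \<longleftrightarrow> infinite_orbit X i q \<and>
     filterlim (\<lambda>j. INF t\<in>Gamma_dom X i q j. norm (Gamma_orbit X i q j t)) at_top sequentially"

text \<open>\<open>infdist z {}\<close> is \<open>0\<close>, so this is meaningful for non-empty \<open>K\<close> only.\<close>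

definition converges_to_set :: "hybrid_system \<Rightarrow> zone \<Rightarrow> plane \<Rightarrow> plane set \<Rightarrow> bool" where
  "converges_to_set X i q K \<longleftrightarrow> infinite_orbit X i q \<and>
     (\<lambda>j. SUP t\<in>Gamma_dom X i q j. infdist (Gamma_orbit X i q j t) K) \<longlonglongrightarrow> 0"

end

theory Submission
  imports Defs
begin

text \<open>Far from the origin a system of this class acts on the line almost like its reset map alone,
  and the asymptotics of the reset map decide everything.

  An affine field with a center is \<open>z \<mapsto> L (z - c)\<close> with \<open>L\<^sup>2 = - \<omega>\<^sup>2\<close>, \<open>\<omega> > 0\<close>
  (\<open>center_square\<close>). Its flow is therefore the linear rotation
  \<open>cos (\<omega> t) + (sin (\<omega> t) / \<omega>) L\<close> about \<open>c\<close>, which changes the distance from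
  \<open>c\<close> by a bounded factor only, uniformly in time (\<open>flow_bounds\<close>). The ellipses are level sets of a quadratic form in which the
  \<open>y\<close>-coordinate has a non-zero square term, so an ellipse that crosses the line does so at
  two heights whose midpoint is the same for all ellipses of one field. A piece that starts on the line at
  height \<open>y\<close> thus ends at height \<open>y\<close> or at its mirror image, and \<open>\<bar>y\<bar>\<close> changes by a
  bounded amount (\<open>line_return_almost_isometric\<close>). A piece that starts far away inside a half plane
  lies on an ellipse too large to miss the line (\<open>large_orbit_meets_line\<close>).

  From its second piece on, an orbit with a remote starting point is hence described by heights
  \<open>y j\<close> that satisfy \<open>y (j + 1) = \<phi> (e (j + 1))\<close>, where \<open>\<bar>e (j + 1)\<bar>\<close> and \<open>\<bar>y j\<bar>\<close> differ
  by at most a constant (\<open>orbit_line_sequence\<close>). If the degree of \<open>\<phi>\<close> is at least 2, or if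
  \<open>\<phi>\<close> is affine with slope larger than 1 in modulus, then \<open>\<bar>\<phi> y\<bar> - \<bar>y\<bar>\<close> tends to infinity,
  which beats the bounded error, and the heights go to infinity. If \<open>\<phi>\<close> is affine with slope smaller
  than 1 in modulus, the heights end up in a fixed bounded interval. The norm distortion carries both
  conclusions from the starting points to the whole pieces; \<open>K\<close> is a sufficiently large disc, which
  in the last case contains all pieces from some index on.\<close>

section \<open>The linear part of a center\<close>

lemma exponential_periodic_trivial:
  fixes f :: "real \<Rightarrow> real"
  assumes f': "\<And>t. (f has_real_derivative k * f t) (at t)"
    and T: "T > 0" "f T = f 0"
  shows "k = 0 \<or> f 0 = 0"
proof -
  define g where "g t = f t * exp (- k * t)" for t
  have "(g has_real_derivative 0) (at t)" for t
    unfolding g_def by (auto intro!: derivative_eq_intros f' simp: algebra_simps)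
  then have "g T = g 0"
    using DERIV_isconst_all by blast
  then have "f 0 * (exp (- k * T) - 1) = 0"
    by (simp add: g_def T algebra_simps)
  then show ?thesis
    using T by auto
qed

lemma linear_growth_periodic_trivial:
  fixes f :: "real \<Rightarrow> real"
  assumes f': "\<And>t. (f has_real_derivative k) (at t)"
    and T: "T > 0" "f T = f 0"
  shows "k = 0"
proof -
  have "((\<lambda>t. f t - k * t) has_real_derivative 0) (at t)" for t
    by (auto intro!: derivative_eq_intros f')
  then have "f T - k * T = f 0 - k * 0"
    using DERIV_isconst_all by blast
  then show ?thesis using T by simp
qed

text \<open>Translating the singularity to the origin reduces affine fields to linear ones.\<close>

lemma solution_affine_iff:
  assumes "linear L"
  shows "solution (\<lambda>z. L (z - c)) q \<gamma> \<longleftrightarrow> solution L (q - c) (\<lambda>t. \<gamma> t - c)"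
proof -
  have "((\<lambda>t. \<gamma> t - c) has_vector_derivative v) (at t) \<longleftrightarrow> (\<gamma> has_vector_derivative v) (at t)" for v t
    using has_vector_derivative_add[of "\<lambda>t. \<gamma> t - c" v "at t" "\<lambda>_. c" 0]
    by (auto intro!: derivative_eq_intros)
  then show ?thesis
    by (auto simp: solution_def)
qed

lemma solution_scale:
  assumes "linear L" "solution L w u"
  shows "solution L (r *\<^sub>R w) (\<lambda>t. r *\<^sub>R u t)"
  using assms
  by (auto simp: solution_def linear_scale intro!: derivative_eq_intros)

text \<open>A center only speaks of orbits near the singularity, but the solutions of a linear equation can be
  rescaled, so every non-zero vector lies on a non-constant periodic orbit.\<close>

lemma center_periodic_solutions:
  assumes L: "linear L" and center: "is_center (\<lambda>z. L (z - c)) c" and w: "w \<noteq> 0"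
  obtains u T t where "solution L w u" "T > 0" "u T = w" "u t \<noteq> w"
proof -
  obtain U where U: "open U" "c \<in> U" and
    per: "\<And>q. q \<in> U - {c} \<Longrightarrow> \<exists>\<gamma> T. solution (\<lambda>z. L (z - c)) q \<gamma> \<and> T > 0 \<and>
       (\<forall>t. \<gamma> (t + T) = \<gamma> t) \<and> (\<exists>t. \<gamma> t \<noteq> q)"
    using center unfolding is_center_def by blast
  obtain e where e: "e > 0" "ball c e \<subseteq> U"
    using U openE by blast
  define r where "r = e / (2 * norm w)"
  have r: "r > 0" and rw: "norm (r *\<^sub>R w) < e"
    using w e by (auto simp: r_def)
  have "c + r *\<^sub>R w \<in> U - {c}"
    using w r rw e by (auto simp: dist_norm)
  from per[OF this] obtain \<gamma> T t where \<gamma>: "solution (\<lambda>z. L (z - c)) (c + r *\<^sub>R w) \<gamma>"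
    and T: "T > 0" "\<And>t. \<gamma> (t + T) = \<gamma> t" and t: "\<gamma> t \<noteq> c + r *\<^sub>R w"
    by blast
  have "solution L (r *\<^sub>R w) (\<lambda>t. \<gamma> t - c)"
    using \<gamma> by (simp add: solution_affine_iff[OF L])
  from solution_scale[OF L this, of "1 / r"]
  have "solution L w (\<lambda>t. (1 / r) *\<^sub>R (\<gamma> t - c))"
    using r by simp
  moreover have "(1 / r) *\<^sub>R (\<gamma> T - c) = w"
    using T(2)[of 0] \<gamma> r by (simp add: solution_def)
  moreover have "(1 / r) *\<^sub>R (\<gamma> t - c) \<noteq> w"
  proof
    assume "(1 / r) *\<^sub>R (\<gamma> t - c) = w"
    then have "r *\<^sub>R w = \<gamma> t - c" using r by auto
    with t show False by simp
  qed
  ultimately show thesis using that T(1) by blast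
qed

lemma linear_plane_coeffs:
  assumes "linear (L :: plane \<Rightarrow> plane)"
  obtains a b c d where "\<And>x y. L (x, y) = (a * x + b * y, c * x + d * y)"
proof -
  define a b c d where "a = fst (L (1, 0))" and "b = fst (L (0, 1))"
    and "c = snd (L (1, 0))" and "d = snd (L (0, 1))"
  have "L (x, y) = (a * x + b * y, c * x + d * y)" for x y
  proof -
    have "L (x, y) = L (x *\<^sub>R (1, 0) + y *\<^sub>R (0, 1))" by simp
    also have "\<dots> = x *\<^sub>R L (1, 0) + y *\<^sub>R L (0, 1)"
      by (simp only: linear_add[OF assms] linear_scale[OF assms])
    finally show ?thesis
      by (simp add: prod_eq_iff a_def b_def c_def d_def)
  qed
  then show thesis using that by blast
qed

lemma solution_coordinates:
  assumes "solution L w u" and L: "\<And>x y. L (x, y) = (a * x + b * y, c * x + d * y)"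
  shows "((\<lambda>t. fst (u t)) has_real_derivative a * fst (u t) + b * snd (u t)) (at t)"
    and "((\<lambda>t. snd (u t)) has_real_derivative c * fst (u t) + d * snd (u t)) (at t)"
proof -
  have "(u has_vector_derivative L (u t)) (at t)"
    using assms(1) by (simp add: solution_def)
  from bounded_linear.has_vector_derivative[OF bounded_linear_fst this]
    bounded_linear.has_vector_derivative[OF bounded_linear_snd this]
  show "((\<lambda>t. fst (u t)) has_real_derivative a * fst (u t) + b * snd (u t)) (at t)"
    and "((\<lambda>t. snd (u t)) has_real_derivative c * fst (u t) + d * snd (u t)) (at t)"
    using L[of "fst (u t)" "snd (u t)"]
    by (simp_all add: has_real_derivative_iff_has_vector_derivative)
qed

text \<open>Periodicity forbids every solution component that grows exponentially or linearly. Write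
  \<open>a, b, c, d\<close> for the entries of \<open>L\<close>. The form \<open>Q w = det (w, L w)\<close> satisfies
  \<open>Q' = (a + d) Q\<close> along solutions, which forces the trace to vanish; by Cayley-Hamilton
  \<open>L\<^sup>2 = - \<delta>\<close> with \<open>\<delta> = det L\<close>. If \<open>\<delta>\<close> were 0, solutions would be affine in time;
  if it were negative, the real eigenvalues \<open>\<plusminus> sqrt (- \<delta>)\<close> would produce exponentials.\<close>

lemma center_square:
  assumes L: "linear L" and center: "is_center (\<lambda>z. L (z - p)) p"
  obtains \<omega> where "\<omega> > 0" "\<And>w. L (L w) = - (\<omega>\<^sup>2 *\<^sub>R w)"
proof -
  obtain a b c d where Lc: "\<And>x y. L (x, y) = (a * x + b * y, c * x + d * y)"
    using linear_plane_coeffs[OF L] by metis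
  define \<delta> where "\<delta> = a * d - b * c"
  define Q where "Q w = c * (fst w)\<^sup>2 + (d - a) * fst w * snd w - b * (snd w)\<^sup>2" for w :: plane
  have nz: "(1, 0) \<noteq> (0 :: plane)" by (simp add: zero_prod_def)
  have trace: "a + d = 0"
  proof (cases "\<exists>w. Q w \<noteq> 0")
    case True
    then obtain w where w: "Q w \<noteq> 0" by blast
    then have "w \<noteq> 0" by (auto simp: Q_def)
    then obtain u T where u: "solution L w u" "T > 0" "u T = w"
      using center_periodic_solutions[OF L center] by metis
    note D = solution_coordinates[OF u(1) Lc]
    have "((\<lambda>t. Q (u t)) has_real_derivative (a + d) * Q (u t)) (at t)" for t
      unfolding Q_def
      by (rule derivative_eq_intros D refl)+ (simp add: algebra_simps power2_eq_square)
    from exponential_periodic_trivial[OF this u(2)] w u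
    show ?thesis by (auto simp: solution_def)
  next
    case False
    \<comment> \<open>If \<open>Q\<close> vanishes identically, every vector is an eigenvector, so \<open>L\<close> is a multiple of the identity.\<close>
    then have "Q (1, 0) = 0" "Q (0, 1) = 0" "Q (1, 1) = 0" by auto
    then have *: "c = 0" "b = 0" "d = a" by (auto simp: Q_def)
    obtain u T where u: "solution L (1, 0) u" "T > 0" "u T = (1, 0)"
      using center_periodic_solutions[OF L center, OF nz] by metis
    have "((\<lambda>t. fst (u t)) has_real_derivative a * fst (u t)) (at t)" for t
      using solution_coordinates(1)[OF u(1) Lc] * by simp
    from exponential_periodic_trivial[OF this u(2)] u
    have "a = 0" by (auto simp: solution_def)
    with * show ?thesis by simp
  qed
  then have d: "d = - a" by simp
  have LL: "L (L w) = - (\<delta> *\<^sub>R w)" for w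
    by (cases w) (simp add: Lc \<delta>_def d algebra_simps)
  have "\<delta> > 0"
  proof (rule ccontr)
    obtain u T t where u: "solution L (1, 0) u" "T > 0" "u T = (1, 0)" "u t \<noteq> (1, 0)"
      using center_periodic_solutions[OF L center, OF nz] by metis
    note D = solution_coordinates[OF u(1) Lc]
    have u0: "u 0 = (1, 0)" using u(1) by (simp add: solution_def)
    assume "\<not> \<delta> > 0"
    then consider "\<delta> = 0" | "\<delta> < 0" by linarith
    then show False
    proof cases
      case 1
      then have sq: "a * a + b * c = 0" "d = - a" by (simp_all add: \<delta>_def d)
      have "((\<lambda>t. a * fst (u t) + b * snd (u t)) has_real_derivative 0) (at t)" for t
        by (rule derivative_eq_intros D refl)+ (use sq in algebra)
      then have k1: "a * fst (u t) + b * snd (u t) = a" for t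
        using DERIV_isconst_all[of "\<lambda>t. a * fst (u t) + b * snd (u t)" t 0] u0 by simp
      have "((\<lambda>t. c * fst (u t) + d * snd (u t)) has_real_derivative 0) (at t)" for t
        by (rule derivative_eq_intros D refl)+ (use sq in algebra)
      then have k2: "c * fst (u t) + d * snd (u t) = c" for t
        using DERIV_isconst_all[of "\<lambda>t. c * fst (u t) + d * snd (u t)" t 0] u0 by simp
      note D' = D[unfolded k1 k2]
      have "a = 0" "c = 0"
        using linear_growth_periodic_trivial[OF D'(1) u(2)]
          linear_growth_periodic_trivial[OF D'(2) u(2)] u u0 by auto
      with D' have "((\<lambda>t. fst (u t)) has_real_derivative 0) (at t)"
        "((\<lambda>t. snd (u t)) has_real_derivative 0) (at t)" for t
        by simp_all
      then have "fst (u t) = fst (u 0)" "snd (u t) = snd (u 0)"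
        using DERIV_isconst_all by blast+
      with u u0 show False by (simp add: prod_eq_iff)
    next
      case 2
      define \<mu> where "\<mu> = sqrt (- \<delta>)"
      have \<mu>: "\<mu> > 0" "\<mu>\<^sup>2 = a\<^sup>2 + b * c"
        using 2 by (auto simp: \<mu>_def \<delta>_def d power2_eq_square)
      \<comment> \<open>A square root \<open>s\<close> of \<open>- \<delta>\<close> is an eigenvalue of \<open>L\<close>, and the first coordinate of
        \<open>s w + L w\<close>, as a function of \<open>w\<close>, is a left eigenvector for it; its value at \<open>(1, 0)\<close> is \<open>s + a\<close>.\<close>
      have "s = 0 \<or> s + a = 0" if s: "s\<^sup>2 = a\<^sup>2 + b * c" for s
      proof -
        have "((\<lambda>t. s * fst (u t) + (a * fst (u t) + b * snd (u t))) has_real_derivative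
          s * (s * fst (u t) + (a * fst (u t) + b * snd (u t)))) (at t)" for t
          by (rule derivative_eq_intros D refl)+ (use s d in algebra)
        from exponential_periodic_trivial[OF this u(2)] u0 u(3)
        show ?thesis by simp
      qed
      from this[of \<mu>] this[of "- \<mu>"] \<mu> show False by auto
    qed
  qed
  then show thesis
    using that[of "sqrt \<delta>"] LL by simp
qed

section \<open>The flow around a center\<close>

locale linear_center =
  fixes L :: "plane \<Rightarrow> plane" and c :: plane and \<omega> :: real
  assumes linear: "linear L"
    and square: "\<And>w. L (L w) = - (\<omega>\<^sup>2 *\<^sub>R w)"
    and \<omega>_pos: "\<omega> > 0"
begin

text \<open>The exponential of \<open>t L\<close>, a rotation along ellipses because \<open>L\<^sup>2 = - \<omega>\<^sup>2\<close>.\<close>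

definition rot :: "real \<Rightarrow> plane \<Rightarrow> plane" where
  "rot t w = cos (\<omega> * t) *\<^sub>R w + (sin (\<omega> * t) / \<omega>) *\<^sub>R L w"

lemmas L_simps = linear_add[OF linear] linear_scale[OF linear] linear_diff[OF linear] square

lemma L_rot: "L (rot t w) = cos (\<omega> * t) *\<^sub>R L w - (\<omega> * sin (\<omega> * t)) *\<^sub>R w"
  using \<omega>_pos by (simp add: rot_def L_simps power2_eq_square)

lemma rot_0 [simp]: "rot 0 w = w"
  by (simp add: rot_def)

lemma rot_inverse: "rot (- t) (rot t w) = w"
proof -
  define \<alpha> \<beta> where "\<alpha> = cos (\<omega> * t)" and "\<beta> = sin (\<omega> * t)"
  have "rot (- t) (rot t w) = \<alpha> *\<^sub>R rot t w - (\<beta> / \<omega>) *\<^sub>R L (rot t w)"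
    by (simp add: rot_def [of "- t"] \<alpha>_def \<beta>_def)
  also have "\<dots> = (\<alpha>\<^sup>2 + \<beta>\<^sup>2) *\<^sub>R w"
    unfolding L_rot unfolding rot_def \<alpha>_def[symmetric] \<beta>_def[symmetric] using \<omega>_pos
    by (simp add: scaleR_diff_right scaleR_add_right scaleR_add_left power2_eq_square mult.commute)
  finally show ?thesis by (simp add: \<alpha>_def \<beta>_def)
qed

lemma rot_half_turn: "rot (t + pi / \<omega>) w = - rot t w"
proof -
  have "\<omega> * (t + pi / \<omega>) = \<omega> * t + pi" using \<omega>_pos by (simp add: field_simps)
  then show ?thesis by (simp add: rot_def)
qed

lemma has_vector_derivative_rot: "((\<lambda>t. rot t w) has_vector_derivative L (rot t w)) (at t)"
  unfolding L_rot unfolding rot_def using \<omega>_pos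
  by (auto intro!: derivative_eq_intros simp: algebra_simps)

text \<open>Rotating a solution back gives a curve with zero derivative, which is therefore constant.\<close>

lemma solution_linear_unique:
  assumes "solution L w u"
  shows "u t = rot t w"
proof -
  have u: "u 0 = w" "\<And>t. (u has_vector_derivative L (u t)) (at t)"
    using assms by (auto simp: solution_def)
  have Lu: "((\<lambda>t. L (u t)) has_vector_derivative L (L (u t))) (at t)" for t
    using bounded_linear.has_vector_derivative[OF linear_linear[THEN iffD2, OF linear] u(2)] .
  have "((\<lambda>t. rot (- t) (u t)) has_vector_derivative 0) (at t)" for t
    unfolding rot_def using \<omega>_pos
    by (auto intro!: derivative_eq_intros u(2) Lu simp: square power2_eq_square algebra_simps)
  then obtain k where k: "\<And>t. rot (- t) (u t) = k"
    using has_vector_derivative_zero_constant[of UNIV "\<lambda>t. rot (- t) (u t)"] by auto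
  have "rot (- t) (u t) = rot (- 0) (u 0)"
    unfolding k ..
  then show ?thesis
    using rot_inverse[of "- t" "u t"] u(1) by simp
qed

lemma flow_eq: "flow (\<lambda>z. L (z - c)) q t = c + rot t (q - c)"
proof -
  have "flow (\<lambda>z. L (z - c)) q = (\<lambda>t. c + rot t (q - c))"
    unfolding flow_def
  proof (rule the_equality)
    show "solution (\<lambda>z. L (z - c)) q (\<lambda>t. c + rot t (q - c))"
      using has_vector_derivative_rot by (simp add: solution_affine_iff[OF linear] solution_def)
  next
    fix \<gamma> assume "solution (\<lambda>z. L (z - c)) q \<gamma>"
    then have \<gamma>: "\<gamma> t - c = rot t (q - c)" for t
      using solution_linear_unique by (simp add: solution_affine_iff[OF linear])
    show "\<gamma> = (\<lambda>t. c + rot t (q - c))"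
      by (simp add: \<gamma>[symmetric])
  qed
  then show ?thesis by simp
qed

text \<open>The upper bound is uniform in time; the lower one is the upper bound for the inverse rotation.\<close>

lemma rot_bound: "\<exists>B>0. \<forall>t w. norm (rot t w) \<le> B * norm w \<and> norm w \<le> B * norm (rot t w)"
proof -
  obtain B where B: "B > 0" "\<And>w. norm (L w) \<le> B * norm w"
    using linear_bounded_pos[OF linear] by blast
  have *: "norm (rot t w) \<le> (1 + B / \<omega>) * norm w" for t w
  proof -
    have "norm (rot t w) \<le> \<bar>cos (\<omega> * t)\<bar> * norm w + \<bar>sin (\<omega> * t)\<bar> / \<omega> * norm (L w)"
      unfolding rot_def using norm_triangle_ineq \<omega>_pos by (metis abs_divide abs_of_pos norm_scaleR)
    also have "\<dots> \<le> 1 * norm w + 1 / \<omega> * (B * norm w)"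
      using \<omega>_pos B by (intro add_mono mult_mono divide_right_mono) auto
    finally show ?thesis by (simp add: algebra_simps)
  qed
  from *[of "- t" "rot t w" for t w] have "norm w \<le> (1 + B / \<omega>) * norm (rot t w)" for t w
    by (simp add: rot_inverse)
  with * B \<omega>_pos show ?thesis
    by (intro exI[of _ "1 + B / \<omega>"]) (auto simp: add_pos_pos)
qed

lemma flow_bounds:
  "\<forall>\<^sub>F C in at_top. \<forall>p t. norm (flow (\<lambda>z. L (z - c)) p t) \<le> C * (norm p + 1) \<and>
     norm p \<le> C * (norm (flow (\<lambda>z. L (z - c)) p t) + 1)"
proof -
  obtain B where B: "B > 0" "\<And>t w. norm (rot t w) \<le> B * norm w"
    "\<And>t w. norm w \<le> B * norm (rot t w)"
    using rot_bound by blast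
  define M where "M = (B + 1) * norm c"
  have key: "norm x \<le> C * (norm y + 1)"
    if "C \<ge> B + M" "norm (x - c) \<le> B * norm (y - c)" for C and x y :: plane
  proof -
    have M: "M \<ge> 0" using B by (simp add: M_def)
    have "norm x \<le> norm (x - c) + norm c" by (metis diff_add_cancel norm_triangle_ineq)
    also have "\<dots> \<le> B * (norm y + norm c) + norm c"
      using that(2) norm_triangle_ineq4[of y c] B(1)
      by (meson add_right_mono dual_order.trans less_imp_le mult_left_mono)
    also have "\<dots> = B * norm y + M" by (simp add: M_def algebra_simps)
    also have "\<dots> \<le> (B + M) * norm y + (B + M)"
      using M B by (intro add_mono mult_right_mono) auto
    also have "\<dots> = (B + M) * (norm y + 1)" by (simp add: algebra_simps)
    also have "\<dots> \<le> C * (norm y + 1)" using that(1) by (intro mult_right_mono) auto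
    finally show ?thesis .
  qed
  show ?thesis
    unfolding eventually_at_top_linorder flow_eq
    by (intro exI[of _ "B + M"] allI impI conjI key) (use B in auto)
qed

text \<open>The inequality says that the field crosses the vertical line except at one height: if \<open>b\<close>
  were 0, the vertical axis would be invariant and carry a real eigenvalue.\<close>

lemma coefficients:
  obtains a b a' d where "\<And>x y. L (x, y) = (a * x + b * y, a' * x + d * y)" "b \<noteq> 0"
proof -
  obtain a b a' d where ab: "\<And>x y. L (x, y) = (a * x + b * y, a' * x + d * y)"
    using linear_plane_coeffs[OF linear] by metis
  have "a' * b + d * d = - \<omega>\<^sup>2"
    using square[of "(0, 1)"] by (simp add: ab)
  then have "b \<noteq> 0"
    using \<omega>_pos by (metis add_0 le_minus_iff mult_zero_right neg_0_equal_iff_equal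
        not_square_less_zero power2_less_0 zero_less_power neg_less_0_iff_less)
  with ab that show thesis by blast
qed

text \<open>The quadratic form \<open>det (w, L w)\<close>, whose level sets are the ellipses traced by \<open>rot\<close>.\<close>

definition energy :: "plane \<Rightarrow> real" where
  "energy w = fst w * snd (L w) - snd w * fst (L w)"

lemma energy_rot: "energy (rot t w) = energy w"
proof -
  define \<alpha> \<beta> where "\<alpha> = cos (\<omega> * t)" and "\<beta> = sin (\<omega> * t) / \<omega>"
  have r: "rot t w = \<alpha> *\<^sub>R w + \<beta> *\<^sub>R L w" by (simp add: rot_def \<alpha>_def \<beta>_def)
  have Lr: "L (rot t w) = \<alpha> *\<^sub>R L w - (\<beta> * \<omega>\<^sup>2) *\<^sub>R w"
    unfolding r by (simp add: L_simps)
  have one: "\<alpha>\<^sup>2 + \<beta>\<^sup>2 * \<omega>\<^sup>2 = 1"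
    using \<omega>_pos by (simp add: \<alpha>_def \<beta>_def power_divide)
  have "energy (rot t w) = (\<alpha>\<^sup>2 + \<beta>\<^sup>2 * \<omega>\<^sup>2) * energy w"
    unfolding energy_def Lr unfolding r by (simp add: algebra_simps power2_eq_square)
  with one show ?thesis by simp
qed

text \<open>On the line the conserved form is a quadratic polynomial in the height with leading coefficient
  \<open>- b \<noteq> 0\<close>, so two heights with the same value coincide or have the sum \<open>E\<close> prescribed by Vieta.\<close>

lemma line_return_almost_isometric:
  "\<exists>D. \<forall>p t. p \<in> Sigma_line \<longrightarrow> flow (\<lambda>z. L (z - c)) p t \<in> Sigma_line \<longrightarrow>
     \<bar>\<bar>snd (flow (\<lambda>z. L (z - c)) p t)\<bar> - \<bar>snd p\<bar>\<bar> \<le> D"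
proof -
  obtain a b a' d where ab: "\<And>x y. L (x, y) = (a * x + b * y, a' * x + d * y)" "b \<noteq> 0"
    using coefficients by metis
  define E where "E = 2 * snd c + (a - d) * fst c / b"
  have "\<bar>\<bar>y'\<bar> - \<bar>y\<bar>\<bar> \<le> \<bar>E\<bar>"
    if "fst p = 0" "y = snd p" and e: "e = flow (\<lambda>z. L (z - c)) p t" "fst e = 0" "y' = snd e"
    for p e t y y'
  proof -
    have "energy (e - c) = energy (p - c)"
      by (simp add: e(1) flow_eq energy_rot)
    moreover have "e - c = (- fst c, y' - snd c)" "p - c = (- fst c, y - snd c)"
      using that by (simp_all add: prod_eq_iff)
    ultimately have "- (fst c * (d * (y' - snd c) - a' * fst c)) - (y' - snd c) * (b * (y' - snd c) - a * fst c) =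
        - (fst c * (d * (y - snd c) - a' * fst c)) - (y - snd c) * (b * (y - snd c) - a * fst c)"
      by (simp add: energy_def ab(1))
    then have "(y' - y) * (b * (y' + y) - (2 * b * snd c + (a - d) * fst c)) = 0"
      by algebra
    then have "y' = y \<or> b * (y' + y) = 2 * b * snd c + (a - d) * fst c" by auto
    then have "y' = y \<or> y' + y = E"
      using ab(2) by (auto simp: E_def field_simps)
    then show ?thesis by linarith
  qed
  then show ?thesis
    by (intro exI[of _ "\<bar>E\<bar>"]) (auto simp: Sigma_line_def)
qed

lemma continuous_flow: "continuous_on A (\<lambda>t. fst (flow (\<lambda>z. L (z - c)) p t))"
  unfolding flow_eq rot_def using \<omega>_pos by (auto intro!: continuous_intros)

lemma line_point_returns:
  assumes "p \<in> Sigma_line"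
  shows "\<exists>t>0. flow (\<lambda>z. L (z - c)) p t \<in> Sigma_line"
proof -
  \<comment> \<open>A full turn is two half turns; the summand 0 makes the half-turn rule apply to both.\<close>
  have "rot (0 + pi / \<omega> + pi / \<omega>) (p - c) = p - c"
    unfolding rot_half_turn by simp
  then have "flow (\<lambda>z. L (z - c)) p (0 + pi / \<omega> + pi / \<omega>) = p"
    by (simp add: flow_eq)
  then show ?thesis
    using assms \<omega>_pos by (intro exI[of _ "0 + pi / \<omega> + pi / \<omega>"]) (auto intro!: add_pos_pos)
qed

text \<open>The first coordinate oscillates around \<open>fst c\<close> with opposite deviations half a turn apart, so it
  changes sign once its amplitude exceeds \<open>\<bar>fst c\<bar>\<close>. The deviations at time 0 and a quarter turn
  later are \<open>fst w\<close> and \<open>fst (L w) / \<omega>\<close> with \<open>w = p - c\<close>; as \<open>b \<noteq> 0\<close> they determine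
  \<open>w\<close>, so one of them is large when \<open>p\<close> is.\<close>

lemma large_orbit_meets_line:
  "\<forall>\<^sub>F R in at_top. \<forall>p. norm p \<ge> R \<longrightarrow> (\<exists>t>0. flow (\<lambda>z. L (z - c)) p t \<in> Sigma_line)"
proof -
  obtain a b a' d where ab: "\<And>x y. L (x, y) = (a * x + b * y, a' * x + d * y)" "b \<noteq> 0"
    using coefficients by metis
  define k where "k = 1 + (\<omega> + \<bar>a\<bar>) / \<bar>b\<bar>"
  have amplitude: "norm w \<le> m * k" if "\<bar>fst w\<bar> \<le> m" "\<bar>fst (L w)\<bar> \<le> \<omega> * m" for w m
  proof -
    obtain x y where w: "w = (x, y)" by fastforce
    have "\<bar>b * y\<bar> \<le> \<bar>a * x + b * y\<bar> + \<bar>a\<bar> * \<bar>x\<bar>"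
      by (simp add: abs_mult[symmetric])
    also have "\<dots> \<le> \<omega> * m + \<bar>a\<bar> * m"
      using that w by (intro add_mono mult_left_mono) (auto simp: ab)
    finally have "\<bar>y\<bar> \<le> m * ((\<omega> + \<bar>a\<bar>) / \<bar>b\<bar>)"
      using ab(2) by (simp add: abs_mult field_simps)
    moreover have "norm w \<le> \<bar>x\<bar> + \<bar>y\<bar>"
      unfolding w by (metis norm_Pair_le real_norm_def)
    ultimately show ?thesis using that w by (simp add: k_def algebra_simps)
  qed
  have "\<exists>t>0. flow (\<lambda>z. L (z - c)) p t \<in> Sigma_line" if p: "norm p > \<bar>fst c\<bar> * k + norm c" for p
  proof -
    define f where "f t = fst (flow (\<lambda>z. L (z - c)) p t)" for t
    have "norm (p - c) > \<bar>fst c\<bar> * k"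
      using p norm_triangle_ineq2[of p c] by simp
    then have "\<bar>fst (p - c)\<bar> > \<bar>fst c\<bar> \<or> \<bar>fst (L (p - c))\<bar> > \<omega> * \<bar>fst c\<bar>"
      using amplitude[of "p - c" "\<bar>fst c\<bar>"] by linarith
    then obtain s where s: "s \<ge> 0" "\<bar>fst (rot s (p - c))\<bar> > \<bar>fst c\<bar>"
    proof
      assume "\<bar>fst (p - c)\<bar> > \<bar>fst c\<bar>"
      then show thesis using that[of 0] by simp
    next
      assume *: "\<bar>fst (L (p - c))\<bar> > \<omega> * \<bar>fst c\<bar>"
      have "rot (pi / (2 * \<omega>)) (p - c) = (1 / \<omega>) *\<^sub>R L (p - c)"
        using \<omega>_pos by (simp add: rot_def)
      then show thesis
        using that[of "pi / (2 * \<omega>)"] * \<omega>_pos by (simp add: abs_mult field_simps)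
    qed
    define s' where "s' = s + pi / \<omega>"
    have ss: "s \<le> s'" using \<omega>_pos by (simp add: s'_def)
    have f: "f s = fst c + fst (rot s (p - c))" "f s' = fst c - fst (rot s (p - c))"
      by (simp_all add: f_def flow_eq s'_def rot_half_turn)
    have cont: "continuous_on {s..s'} f"
      unfolding f_def by (rule continuous_flow)
    have "\<exists>t\<ge>s. t \<le> s' \<and> f t = 0"
    proof (cases "fst (rot s (p - c)) > 0")
      case True
      then show ?thesis using IVT2'[of f s' 0 s] s f ss cont by auto
    next
      case False
      then show ?thesis using IVT'[of f s 0 s'] s f ss cont by auto
    qed
    then obtain t where t: "t \<ge> s" "f t = 0" by blast
    moreover have "f s \<noteq> 0" using s f by auto
    ultimately have "t > 0" using s by (metis less_eq_real_def order_less_le_trans)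
    with t show ?thesis by (auto simp: f_def Sigma_line_def)
  qed
  then show ?thesis
    unfolding eventually_at_top_linorder
    by (intro exI[of _ "\<bar>fst c\<bar> * k + norm c + 1"]) auto
qed

text \<open>A least positive hitting time exists because the times at which the flow is on the line form a closed
  set that, for a moving piece, has no element in some interval \<open>(0, \<epsilon>)\<close>.\<close>

lemma first_hit:
  assumes X: "field_of X i = (\<lambda>z. L (z - c))"
    and "moving X i p" "meets_line X i p"
  shows "hit_time X i p > 0" "flow (field_of X i) p (hit_time X i p) \<in> Sigma_line"
proof -
  define f where "f t = fst (flow (field_of X i) p t)" for t
  have cont: "continuous_on A f" for A
    unfolding f_def X by (rule continuous_flow)
  have "\<exists>\<epsilon>>0. \<forall>t. 0 < t \<and> t < \<epsilon> \<longrightarrow> f t \<noteq> 0"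
  proof (cases "p \<in> half_plane i")
    case True
    then have "f 0 \<noteq> 0"
      using X by (cases i) (auto simp: f_def flow_eq)
    moreover have "isCont f 0"
      using cont[of UNIV] by (simp add: continuous_on_eq_continuous_at)
    ultimately obtain \<epsilon> where "\<epsilon> > 0" "\<And>t. dist 0 t < \<epsilon> \<Longrightarrow> f t \<noteq> 0"
      using continuous_at_avoid by metis
    then show ?thesis
      by (intro exI[of _ \<epsilon>]) auto
  next
    case False
    then have "enters X i p" using assms(2) by (auto simp: moving_def)
    then obtain \<epsilon> where "\<epsilon> > 0" "\<And>t. 0 < t \<Longrightarrow> t < \<epsilon> \<Longrightarrow> flow (field_of X i) p t \<in> half_plane i"
      by (auto simp: enters_def)
    then show ?thesis
      by (intro exI[of _ \<epsilon>]) (cases i; force simp: f_def)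
  qed
  then obtain \<epsilon> where \<epsilon>: "\<epsilon> > 0" "\<And>t. 0 < t \<Longrightarrow> t < \<epsilon> \<Longrightarrow> f t \<noteq> 0" by blast
  define S where "S = {t \<in> {\<epsilon>..}. f t = 0}"
  have S: "t \<in> S \<longleftrightarrow> t > 0 \<and> flow (field_of X i) p t \<in> Sigma_line" for t
    using \<epsilon> by (force simp: S_def f_def Sigma_line_def)
  have "closed S"
    unfolding S_def by (intro continuous_closed_preimage_constant cont) auto
  moreover have "S \<noteq> {}" using assms(3) S by (auto simp: meets_line_def)
  moreover have bdd: "bdd_below S" by (auto simp: S_def intro!: bdd_belowI[of _ \<epsilon>])
  ultimately have "Inf S \<in> S" by (intro closed_contains_Inf)
  moreover from this have "hit_time X i p = Inf S"
    unfolding hit_time_def S[symmetric]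
    by (intro Least_equality) (auto intro: cInf_lower bdd)
  ultimately show "hit_time X i p > 0" "flow (field_of X i) p (hit_time X i p) \<in> Sigma_line"
    using S by auto
qed

end

section \<open>Pieces of an orbit\<close>

text \<open>All that the asymptotic analysis needs to know about a zone, gathered with a single constant \<open>C\<close>
  so that it holds for all large \<open>C\<close> and both zones can share one: norms along a piece are comparable with the
  norm of its starting point, pieces from the line return to it with a bounded change of height, and
  pieces from remote points inside the zone reach the line at remote points. That 0 is a time of every
  piece keeps the infima and suprema over pieces meaningful: a badly defined first hitting time could
  make the time domain empty.\<close>

definition piece_control :: "hybrid_system \<Rightarrow> zone \<Rightarrow> real \<Rightarrow> bool" where
  "piece_control X i C \<longleftrightarrow> C \<ge> 1 \<and>
     (\<forall>p t. norm (flow (field_of X i) p t) \<le> C * (norm p + 1)) \<and>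
     (\<forall>p t. norm p \<le> C * (norm (flow (field_of X i) p t) + 1)) \<and>
     (\<forall>p. 0 \<in> piece_times X i p) \<and>
     (\<forall>p\<in>Sigma_line. \<exists>e\<in>Sigma_line. piece_end X i p = Some e \<and> \<bar>\<bar>snd e\<bar> - \<bar>snd p\<bar>\<bar> \<le> C) \<and>
     (\<forall>p\<in>half_plane i. norm p \<ge> C \<longrightarrow> (\<exists>e\<in>Sigma_line. piece_end X i p = Some e \<and>
        norm p \<le> C * (norm e + 1)))"

lemma center_piece_control:
  assumes "affine_field (field_of X i)" "is_center (field_of X i) c"
  shows "\<forall>\<^sub>F C in at_top. piece_control X i C"
proof -
  obtain L b where L: "linear L" "field_of X i = (\<lambda>z. L z + b)"
    using assms(1) by (auto simp: affine_field_def)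
  have "L c + b = 0"
    using assms(2) L(2) by (simp add: is_center_def)
  then have X: "field_of X i = (\<lambda>z. L (z - c))"
    using L by (simp add: linear_diff add_eq_0_iff2)
  obtain \<omega> where "\<omega> > 0" "\<And>w. L (L w) = - (\<omega>\<^sup>2 *\<^sub>R w)"
    using center_square[OF L(1)] assms(2) X by metis
  then interpret linear_center L c \<omega>
    by (intro linear_center.intro L(1))
  note hit = first_hit[OF X]
  obtain D where D: "\<And>p t. p \<in> Sigma_line \<Longrightarrow> flow (field_of X i) p t \<in> Sigma_line \<Longrightarrow>
     \<bar>\<bar>snd (flow (field_of X i) p t)\<bar> - \<bar>snd p\<bar>\<bar> \<le> D"
    using line_return_almost_isometric unfolding X by blast
  have times: "0 \<in> piece_times X i p" for p
    by (auto simp: piece_times_def intro: less_imp_le hit(1))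
  have large: "\<forall>\<^sub>F C in at_top. \<forall>p. norm p \<ge> C \<longrightarrow> meets_line X i p"
    using large_orbit_meets_line by (simp add: meets_line_def X)
  have line: "meets_line X i p" if "p \<in> Sigma_line" for p
    using line_point_returns[OF that] by (simp add: meets_line_def X)
  show ?thesis
    using flow_bounds[folded X] large eventually_ge_at_top[of 1] eventually_ge_at_top[of D]
  proof eventually_elim
    case (elim C)
    have "\<exists>e\<in>Sigma_line. piece_end X i p = Some e \<and> \<bar>\<bar>snd e\<bar> - \<bar>snd p\<bar>\<bar> \<le> C"
      if "p \<in> Sigma_line" for p
      using that hit(2)[of p] D[of p "hit_time X i p"] line[of p] elim
      by (auto simp: piece_end_def)
    moreover have "\<exists>e\<in>Sigma_line. piece_end X i p = Some e \<and> norm p \<le> C * (norm e + 1)"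
      if "p \<in> half_plane i" "norm p \<ge> C" for p
      using that hit(2)[of p] elim(1,2)[rule_format, of p] by (auto simp: piece_end_def moving_def)
    ultimately show ?case
      using elim times by (simp add: piece_control_def)
  qed
qed

lemma norm_line_point: "p \<in> Sigma_line \<Longrightarrow> norm p = \<bar>snd p\<bar>"
  by (cases p) (simp add: Sigma_line_def norm_Pair)

text \<open>Here \<open>y j\<close> is the height at which piece number \<open>j + 1\<close> starts, and \<open>e j\<close> the height at
  which piece number \<open>j\<close> ends. The last inequality makes the first end point remote when \<open>q\<close> is.\<close>

lemma orbit_line_sequence:
  assumes control: "\<And>m. piece_control X m C" and q: "norm q \<ge> C"
  obtains m y e where "\<And>j. orbit_piece X i q (Suc j) = Some (m j, (0, y j))"
    "\<And>j. y j = reset X (e j)" "\<And>j. \<bar>\<bar>e (Suc j)\<bar> - \<bar>y j\<bar>\<bar> \<le> C" "norm q \<le> C * (\<bar>e 0\<bar> + 1)"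
proof -
  have C: "C \<ge> 1" using control by (simp add: piece_control_def)
  have line: "\<exists>e\<in>Sigma_line. piece_end X m p = Some e \<and> \<bar>\<bar>snd e\<bar> - \<bar>snd p\<bar>\<bar> \<le> C"
    if "p \<in> Sigma_line" for m p
    using control[of m] that unfolding piece_control_def by blast
  have first: "\<exists>e\<in>Sigma_line. piece_end X (first_zone i q) q = Some e \<and> norm q \<le> C * (norm e + 1)"
  proof (cases "q \<in> Sigma_line")
    case True
    from line[OF True] obtain e where e: "e \<in> Sigma_line"
      "piece_end X (first_zone i q) q = Some e" "\<bar>\<bar>snd e\<bar> - \<bar>snd q\<bar>\<bar> \<le> C" by blast
    have "norm q \<le> norm e + C"
      using e True by (simp add: norm_line_point)
    also have "\<dots> \<le> C * (norm e + 1)"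
      using C mult_right_mono[of 1 C "norm e"] by (simp add: algebra_simps)
    finally show ?thesis using e by blast
  next
    case False
    then have "q \<in> half_plane (first_zone i q)"
      by (auto simp: first_zone_def Sigma_line_def)
    then show ?thesis
      using control[of "first_zone i q"] q unfolding piece_control_def by blast
  qed
  have ex: "\<exists>m y. orbit_piece X i q (Suc j) = Some (m, (0, y))" for j
  proof (induction j)
    case 0
    show ?case using first by (auto simp: jump_def)
  next
    case (Suc j)
    then obtain m y where my: "orbit_piece X i q (Suc j) = Some (m, (0, y))" by blast
    have "(0, y) \<in> Sigma_line" by (simp add: Sigma_line_def)
    from line[OF this, of m] my show ?case by (auto simp: jump_def)
  qed
  then obtain m y where my: "\<And>j. orbit_piece X i q (Suc j) = Some (m j, (0, y j))"
    by metis
  have "\<exists>e. y j = reset X e \<and> (if j = 0 then norm q \<le> C * (\<bar>e\<bar> + 1)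
      else \<bar>\<bar>e\<bar> - \<bar>y (j - 1)\<bar>\<bar> \<le> C)" for j
  proof (cases j)
    case 0
    from first obtain e where "e \<in> Sigma_line" "piece_end X (first_zone i q) q = Some e"
      "norm q \<le> C * (norm e + 1)" by blast
    with 0 my[of 0] show ?thesis
      by (intro exI[of _ "snd e"]) (simp add: jump_def norm_line_point)
  next
    case (Suc k)
    have "(0, y k) \<in> Sigma_line" by (simp add: Sigma_line_def)
    from line[OF this, of "m k"] obtain e where "piece_end X (m k) (0, y k) = Some e"
      "\<bar>\<bar>snd e\<bar> - \<bar>y k\<bar>\<bar> \<le> C" by auto
    with Suc my[of "Suc k"] my[of k] show ?thesis
      by (intro exI[of _ "snd e"]) (simp add: jump_def)
  qed
  then obtain e where "\<And>j. y j = reset X (e j)" and e: "\<And>j. if j = 0 then norm q \<le> C * (\<bar>e j\<bar> + 1)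
      else \<bar>\<bar>e j\<bar> - \<bar>y (j - 1)\<bar>\<bar> \<le> C"
    by metis
  with my e[of 0] e[of "Suc j" for j] that show thesis by simp
qed

lemma Gamma_dom_nonempty:
  assumes "orbit_piece X i q j = Some (m, p)" "piece_control X m C"
  shows "Gamma_dom X i q j \<noteq> {}"
proof -
  have "0 \<in> piece_times X m p"
    using assms(2) unfolding piece_control_def by blast
  then show ?thesis
    using assms(1) by (auto simp: Gamma_dom_def)
qed

lemma infinite_orbitI:
  assumes "\<And>j. orbit_piece X i q (Suc j) = Some (s j)"
  shows "infinite_orbit X i q"
  unfolding infinite_orbit_def
proof
  fix j show "orbit_piece X i q j \<noteq> None"
    using assms by (cases j) (simp_all del: orbit_piece.simps(2))
qed

section \<open>Expanding and contracting reset maps\<close>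

text \<open>The reset gains \<open>C + 1\<close> in modulus while a piece loses at most \<open>C\<close>, so the heights grow at least
  linearly in \<open>j\<close>, and the norm along a piece is bounded below in terms of its starting height.\<close>

lemma expanding_reset_escapes:
  assumes control: "\<And>m. piece_control X m C"
    and expand: "\<And>y. \<bar>y\<bar> \<ge> R \<Longrightarrow> \<bar>reset X y\<bar> \<ge> \<bar>y\<bar> + C + 1"
    and R: "R \<ge> 0" and q: "norm q \<ge> C * (R + 1)"
  shows "escapes_to_infinity X i q"
proof -
  have C: "C \<ge> 1" using control by (simp add: piece_control_def)
  have "C * R \<ge> 0" using C R by simp
  then have "norm q \<ge> C" using q by (simp add: algebra_simps)
  from orbit_line_sequence[OF control this] obtain m y e
    where orbit: "\<And>j. orbit_piece X i q (Suc j) = Some (m j, (0, y j))"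
    and y: "\<And>j. y j = reset X (e j)" and e: "\<And>j. \<bar>\<bar>e (Suc j)\<bar> - \<bar>y j\<bar>\<bar> \<le> C"
    and e0: "norm q \<le> C * (\<bar>e 0\<bar> + 1)"
    by metis
  have ej: "\<bar>e j\<bar> \<ge> R + real j" for j
  proof (induction j)
    case 0
    have "C * (R + 1) \<le> C * (\<bar>e 0\<bar> + 1)" using q e0 by linarith
    then show ?case using C by simp
  next
    case (Suc j)
    then have "\<bar>y j\<bar> \<ge> \<bar>e j\<bar> + C + 1" using expand y by simp
    with Suc e[of j] show ?case by simp
  qed
  have lower: "(INF t\<in>Gamma_dom X i q (Suc j). norm (Gamma_orbit X i q (Suc j) t)) \<ge> real j / C - 1" for j
  proof (rule cINF_greatest)
    show "Gamma_dom X i q (Suc j) \<noteq> {}"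
      using Gamma_dom_nonempty[OF orbit control] .
  next
    fix t
    have "\<bar>y j\<bar> \<ge> \<bar>e j\<bar> + C + 1" using expand[of "e j"] y ej[of j] by simp
    then have "real j \<le> norm (0 :: real, y j)" using ej[of j] C R by (simp add: norm_Pair)
    also have "\<dots> \<le> C * (norm (flow (field_of X (m j)) (0, y j) t) + 1)"
      using control[of "m j"] unfolding piece_control_def by blast
    finally show "real j / C - 1 \<le> norm (Gamma_orbit X i q (Suc j) t)"
      using C by (simp add: Gamma_orbit_def orbit field_simps del: orbit_piece.simps)
  qed
  have "filterlim (\<lambda>j. real j / C - 1) at_top sequentially"
    using C by real_asymp
  then have "filterlim (\<lambda>j. INF t\<in>Gamma_dom X i q (Suc j). norm (Gamma_orbit X i q (Suc j) t))
      at_top sequentially"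
    by (rule filterlim_at_top_mono) (use lower in auto)
  then have "filterlim (\<lambda>j. INF t\<in>Gamma_dom X i q j. norm (Gamma_orbit X i q j t)) at_top sequentially"
    by (subst filterlim_sequentially_Suc[symmetric])
  then show ?thesis
    unfolding escapes_to_infinity_def using infinite_orbitI[of X i q, OF orbit] by blast
qed

text \<open>The heights obey \<open>\<bar>y (j + 1)\<bar> \<le> \<beta> \<bar>y j\<bar> + (\<beta> C + \<alpha>)\<close>, an affine contraction with fixed point
  \<open>S = (\<beta> C + \<alpha>) / (1 - \<beta>)\<close>, hence are eventually below \<open>S + 1\<close>. Pieces starting there stay in
  the disc of radius \<open>C (S + 2)\<close>, so that their distance to it is exactly 0.\<close>

lemma contracting_reset_converges:
  assumes control: "\<And>m. piece_control X m C"
    and contract: "\<And>y. \<bar>reset X y\<bar> \<le> \<beta> * \<bar>y\<bar> + \<alpha>" and \<beta>: "0 \<le> \<beta>" "\<beta> < 1"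
    and q: "norm q \<ge> C" and \<rho>: "\<rho> \<ge> C * ((\<beta> * C + \<alpha>) / (1 - \<beta>) + 2)"
  shows "converges_to_set X i q (cball 0 \<rho>)"
proof -
  have C: "C \<ge> 1" using control by (simp add: piece_control_def)
  from orbit_line_sequence[OF control q] obtain m y e
    where orbit: "\<And>j. orbit_piece X i q (Suc j) = Some (m j, (0, y j))"
    and y: "\<And>j. y j = reset X (e j)" and e: "\<And>j. \<bar>\<bar>e (Suc j)\<bar> - \<bar>y j\<bar>\<bar> \<le> C"
    by metis
  define S where "S = (\<beta> * C + \<alpha>) / (1 - \<beta>)"
  have S: "\<beta> * S + (\<beta> * C + \<alpha>) = S"
    using \<beta> by (simp add: S_def field_simps)
  have yj: "\<bar>y j\<bar> - S \<le> \<beta> ^ j * (\<bar>y 0\<bar> - S)" for j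
  proof (induction j)
    case (Suc j)
    have "\<bar>y (Suc j)\<bar> \<le> \<beta> * \<bar>e (Suc j)\<bar> + \<alpha>" using y contract by simp
    also have "\<dots> \<le> \<beta> * (\<bar>y j\<bar> + C) + \<alpha>"
      using e[of j] \<beta> by (intro add_right_mono mult_left_mono) auto
    finally have "\<bar>y (Suc j)\<bar> - S \<le> \<beta> * (\<bar>y j\<bar> - S)"
      using S by (simp add: algebra_simps)
    also have "\<dots> \<le> \<beta> * (\<beta> ^ j * (\<bar>y 0\<bar> - S))"
      using Suc \<beta> by (intro mult_left_mono)
    finally show ?case by simp
  qed simp
  have "(\<lambda>j. \<beta> ^ j * (\<bar>y 0\<bar> - S)) \<longlonglongrightarrow> 0"
    using \<beta> by (intro tendsto_mult_left_zero LIMSEQ_realpow_zero)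
  then have "\<forall>\<^sub>F j in sequentially. \<beta> ^ j * (\<bar>y 0\<bar> - S) < 1"
    by (rule order_tendstoD) simp
  then have "\<forall>\<^sub>F j in sequentially.
      (SUP t\<in>Gamma_dom X i q (Suc j). infdist (Gamma_orbit X i q (Suc j) t) (cball 0 \<rho>)) = 0"
  proof eventually_elim
    case (elim j)
    have "Gamma_orbit X i q (Suc j) t \<in> cball 0 \<rho>" for t
    proof -
      have "norm (flow (field_of X (m j)) (0, y j) t) \<le> C * (norm (0 :: real, y j) + 1)"
        using control[of "m j"] unfolding piece_control_def by blast
      also have "\<dots> \<le> C * (S + 2)"
        using elim yj[of j] C by (intro mult_left_mono) (auto simp: norm_Pair)
      also have "\<dots> \<le> \<rho>" using \<rho> by (simp add: S_def)
      finally show ?thesis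
        by (simp add: Gamma_orbit_def orbit del: orbit_piece.simps)
    qed
    moreover have "Gamma_dom X i q (Suc j) \<noteq> {}"
      using Gamma_dom_nonempty[OF orbit control] .
    ultimately show ?case by (simp add: infdist_zero del: orbit_piece.simps)
  qed
  then have "(\<lambda>j. SUP t\<in>Gamma_dom X i q (Suc j). infdist (Gamma_orbit X i q (Suc j) t) (cball 0 \<rho>))
      \<longlonglongrightarrow> 0"
    by (rule tendsto_eventually)
  then have "(\<lambda>j. SUP t\<in>Gamma_dom X i q j. infdist (Gamma_orbit X i q j t) (cball 0 \<rho>)) \<longlonglongrightarrow> 0"
    by (subst filterlim_sequentially_Suc[symmetric])
  then show ?thesis
    unfolding converges_to_set_def using infinite_orbitI[of X i q, OF orbit] by blast
qed

text \<open>Writing \<open>p y = a + y q y\<close>, the claim holds as soon as \<open>\<bar>q y\<bar>\<close> is bounded below by some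
  \<open>\<kappa> > 1\<close> for large \<open>\<bar>y\<bar>\<close>: either \<open>q\<close> is a constant of modulus larger than 1, or it
  tends to infinity.\<close>

lemma polynomial_expands:
  fixes p :: "real poly"
  assumes "degree p \<ge> 1" "degree p = 1 \<Longrightarrow> \<bar>coeff p 1\<bar> > 1"
  obtains R where "R \<ge> 0" "\<And>y. \<bar>y\<bar> \<ge> R \<Longrightarrow> \<bar>poly p y\<bar> \<ge> \<bar>y\<bar> + D"
proof -
  obtain a q where p: "p = pCons a q" by (cases p)
  have "\<exists>\<kappa>>1. \<forall>\<^sub>F y in at_infinity. \<bar>poly q y\<bar> \<ge> \<kappa>"
  proof (cases "degree q = 0")
    case True
    then obtain b where q: "q = [:b:]" using degree_eq_zeroE by blast
    with assms p have "\<bar>b\<bar> > 1" by (auto split: if_splits)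
    with q show ?thesis by (intro exI[of _ "\<bar>b\<bar>"]) simp
  next
    case False
    then have "filterlim (poly q) at_infinity at_infinity"
      by (intro filterlim_poly_at_infinity) simp
    then have "\<forall>\<^sub>F y in at_infinity. \<bar>poly q y\<bar> \<ge> 2"
      using filterlim_at_infinity[of 0 "poly q" at_infinity] by auto
    then show ?thesis by (intro exI[of _ 2]) simp
  qed
  then obtain \<kappa> B where \<kappa>: "\<kappa> > 1" "\<And>y. \<bar>y\<bar> \<ge> B \<Longrightarrow> \<bar>poly q y\<bar> \<ge> \<kappa>"
    by (auto simp: eventually_at_infinity)
  define R where "R = max 0 (max B ((D + \<bar>a\<bar>) / (\<kappa> - 1)))"
  have "\<bar>poly p y\<bar> \<ge> \<bar>y\<bar> + D" if y: "\<bar>y\<bar> \<ge> R" for y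
  proof -
    have "D + \<bar>a\<bar> \<le> \<bar>y\<bar> * (\<kappa> - 1)"
      using y \<kappa>(1) by (simp add: R_def pos_divide_le_eq)
    then have "\<bar>y\<bar> + D \<le> \<bar>y\<bar> * \<kappa> - \<bar>a\<bar>" by (simp add: algebra_simps)
    also have "\<dots> \<le> \<bar>y * poly q y\<bar> - \<bar>a\<bar>"
      using y \<kappa>(2)[of y] by (auto simp: R_def abs_mult intro!: mult_left_mono)
    also have "\<dots> \<le> \<bar>poly p y\<bar>" by (simp add: p)
    finally show ?thesis .
  qed
  then show thesis using that[of R] by (simp add: R_def)
qed

theorem theorem3:
  fixes n :: nat and X :: hybrid_system
  assumes "n \<ge> 1"
    and "X \<in> hybrid_class n"
    and "n = 1 \<Longrightarrow> \<bar>deriv (reset X) 0\<bar> \<noteq> 1"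
  shows "\<exists>K :: (real \<times> real) set. compact K \<and> K \<noteq> {} \<and>
    (\<forall>q. q \<notin> K \<longrightarrow>
       (n \<ge> 2 \<longrightarrow> (\<forall>i. escapes_to_infinity X i q)) \<and>
       (n = 1 \<and> \<bar>deriv (reset X) 0\<bar> > 1 \<longrightarrow> (\<forall>i. escapes_to_infinity X i q)) \<and>
       (n = 1 \<and> \<bar>deriv (reset X) 0\<bar> < 1 \<longrightarrow> (\<forall>i. converges_to_set X i q K)))"
proof -
  obtain p where p: "degree p = n" "reset X = poly p"
    using assms(2) by (auto simp: hybrid_class_def)
  have "\<forall>\<^sub>F C in at_top. piece_control X m C" for m
    using assms(2) center_piece_control unfolding hybrid_class_def by blast
  then have "\<forall>\<^sub>F C in at_top. piece_control X Z1 C \<and> piece_control X Z2 C"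
    by (intro eventually_conj)
  then obtain C where "piece_control X Z1 C" "piece_control X Z2 C"
    unfolding eventually_at_top_linorder by blast
  then have control: "piece_control X m C" for m
    by (cases m) simp_all
  then have C: "C \<ge> 1" by (simp add: piece_control_def)
  have deriv: "deriv (reset X) 0 = coeff p 1"
    unfolding p using DERIV_imp_deriv[OF poly_DERIV[of p 0]]
    by (simp add: poly_0_coeff_0 coeff_pderiv)
  show ?thesis
  proof (cases "n = 1 \<and> \<bar>coeff p 1\<bar> < 1")
    case True
    then obtain \<alpha> \<beta> where ab: "p = [:\<alpha>, \<beta>:]"
      using p(1) by (metis degree1_coeffs)
    define \<rho> where "\<rho> = max C (C * ((\<bar>\<beta>\<bar> * C + \<bar>\<alpha>\<bar>) / (1 - \<bar>\<beta>\<bar>) + 2))"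
    have "\<bar>reset X y\<bar> \<le> \<bar>\<beta>\<bar> * \<bar>y\<bar> + \<bar>\<alpha>\<bar>" for y
      using abs_triangle_ineq[of \<alpha> "y * \<beta>"] by (simp add: p ab abs_mult mult.commute)
    then have "converges_to_set X i q (cball 0 \<rho>)" if "q \<notin> cball 0 \<rho>" for i q
      by (rule contracting_reset_converges[OF control, where \<beta> = "\<bar>\<beta>\<bar>" and \<alpha> = "\<bar>\<alpha>\<bar>"])
        (use True that in \<open>auto simp: ab \<rho>_def\<close>)
    then show ?thesis
      using True C by (intro exI[of _ "cball 0 \<rho>"]) (auto simp: deriv \<rho>_def)
  next
    case False
    then obtain R where R: "R \<ge> 0" "\<And>y. \<bar>y\<bar> \<ge> R \<Longrightarrow> \<bar>poly p y\<bar> \<ge> \<bar>y\<bar> + (C + 1)"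
      using polynomial_expands[of p "C + 1"] assms p deriv by (metis linorder_neqE_linordered_idom)
    then have "escapes_to_infinity X i q" if "q \<notin> cball 0 (C * (R + 1))" for i q
      using that by (intro expanding_reset_escapes[OF control, of R]) (auto simp: p add.assoc)
    moreover have "C * (R + 1) \<ge> 0" using C R by simp
    ultimately show ?thesis
      using False by (intro exI[of _ "cball 0 (C * (R + 1))"]) (auto simp: deriv)
  qed
qed

end
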